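(* Suppose that $\sup_{q\in\mathbb{R}^n}\Big\{\sigma_{\max}\Big(\frac{\partial\mathcal{K}_p(q)}{\partial q}-\Big(\frac{\partial\mathcal{K}_p(q)}{\partial q}\Big)^\top\Big)\Big\}<\infty$ for all $p\in\{1,\ldots,6N\}$. If the lumped velocity $\Psi$ is bounded with $\|\Psi(t)\|\le\Psi^\star$ for all $t\ge0$ with some $\Psi^\star\in[0,\infty)$, then the dynamical effect $H(q,\Psi)\dot q$ of $\Psi$ in the generalized robotics equation remains bounded in the sense that $$\sigma_{\max}(H(q,\Psi(t)))\le\sqrt{6N}\,\Psi^\star\max_{p\in\{1,\ldots,6N\}}\Big\{\sup_{q\in\mathbb{R}^n}\Big\{\sigma_{\max}\Big(\frac{\partial\mathcal{K}_p(q)}{\partial q}-\Big(\frac{\partial\mathcal{K}_p(q)}{\partial q}\Big)^\top\Big)\Big\}\Big\}$$ for all $q\in\mathbb{R}^n$, $t\ge0$, where the maximum on the right-hand side is finite by the supposition.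
   Context: Notation: $\mathrm{I}_p$ is the $p\times p$ identity, $\sigma_{\max}(B)=\sqrt{\lambda_{\max}(B^\top B)}$, $\|\cdot\|$ the Euclidean norm, $\mathrm{e}_{p,6N}\in\mathbb{R}^{6N}$ the $p$th standard unit vector. For $x\in\mathbb{R}^3$, $\mathcal{S}(x)$ is the skew-symmetric $3\times3$ matrix with $\mathcal{S}(x)y=x\times y$ for all $y\in\mathbb{R}^3$. Kinematics: an open kinematic chain of $N$ bodies with generalized coordinates $q\in\mathbb{R}^n$. Kinematic parameters are constant (standing assumption), so the forward kinematic map $F:\mathbb{R}^n\to\mathbb{R}^{6N}$ depends only on $q$; write $F(q)=(F_{z_1}(q)^\top,F_{\phi_1}(q)^\top,\ldots,F_{z_N}(q)^\top,F_{\phi_N}(q)^\top)^\top$ with $F_{z_l},F_{\phi_l}\in\mathbb{R}^3$ (position of the origin and rotation angles of the $l$th body-fixed frame), and $J(q)=\partial F(q)/\partial q\in\mathbb{R}^{6N\times n}$. Rotation angles $\phi\in\mathbb{R}^3$ parameterize rotation matrices $\mathcal{R}(\phi)\in\mathrm{SO}(3)$, and $E(\phi)\in\mathbb{R}^{3\times3}$ is the matrix such that along any differentiable curve $\phi(t)$ one has $\mathcal{R}(\phi)^\top\dot{\mathcal{R}}(\phi)=\mathcal{S}(E(\phi)\dot\phi)$. Set $Q(\phi)=\mathrm{diag}(\mathcal{R}(\phi)^\top,E(\phi))\in\mathbb{R}^{6\times6}$ and $\mathcal{Q}(q)=\mathrm{diag}(Q(F_{\phi_1}(q)),\ldots,Q(F_{\phi_N}(q)))\in\mathbb{R}^{6N\times6N}$.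 The maps $F,\mathcal{R},E$ are smooth enough that the derivatives written exist. For $p\in\{1,\ldots,6N\}$ let $\mathcal{K}_p(q)=(\mathcal{Q}(q)J(q))^\top\mathrm{e}_{p,6N}\in\mathbb{R}^n$, i.e. the transposed $p$th row of $\mathcal{Q}(q)J(q)$; $\partial\mathcal{K}_p(q)/\partial q\in\mathbb{R}^{n\times n}$ is its Jacobian. Lumped velocity: $\Psi(t)=(\psi_1(t)^\top,\ldots,\psi_N(t)^\top)^\top\in\mathbb{R}^{6N}$ with $\psi_l(t)=\int_{\mathbb{R}^3}\varsigma_l(x,t)\rho_l(x,t)\begin{pmatrix}\mathrm{I}_3\\\mathcal{S}(x)\end{pmatrix}\mathscr{v}_l(x,t)\,\mathrm{d}x$, where $\rho_l$ is the mass density of body $l$ in its body-fixed frame, $\varsigma_l\in[0,1]$ is the portion of mass-carrying particles moving relative to that frame, and $\mathscr{v}_l\in\mathbb{R}^3$ is their relative velocity; $\Psi$ is independent of $q$. For $\Psi\in\mathbb{R}^{6N}$, $$H(q,\Psi)=\frac{\partial\big(J(q)^\top\mathcal{Q}(q)^\top\Psi\big)}{\partial q}-\Big(\frac{\partial\big(J(q)^\top\mathcal{Q}(q)^\top\Psi\big)}{\partial q}\Big)^\top\in\mathbb{R}^{n\times n}$$ (with $\Psi$ held fixed in the differentiation). $H(q,\Psi)\dot q$ is the term by which $\Psi$ enters the dynamics (generalized robotics equation) of the manipulator. *)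

theory Defs
  imports "HOL-Analysis.Analysis"
begin

section \<open>Largest singular value\<close>

text \<open>Largest real eigenvalue; it is applied to symmetric matrices only, where the spectrum is
  real, finite and nonempty, so that the maximum is a genuine one.\<close>

definition lambda_max :: "real ^ 'n ^ 'n \<Rightarrow> real" where
  "lambda_max A = Max {l. \<exists>v. v \<noteq> 0 \<and> A *v v = l *\<^sub>R v}"

definition sigma_max :: "real ^ 'n ^ 'm \<Rightarrow> real" where
  "sigma_max B = sqrt (lambda_max (transpose B ** B))"


section \<open>Kinematics of a chain of bodies\<close>

text \<open>The bodies are indexed by a finite type \<open>'b\<close>, so \<open>N = CARD('b)\<close>. The space of dimension
  \<open>6 N\<close> has the index type \<open>'b \<times> (3 + 3)\<close>: the index \<open>(l, Inl i)\<close> is the \<open>i\<close>th translational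
  component belonging to body \<open>l\<close> (for the forward kinematic map: position of the origin of
  the body-fixed frame), \<open>(l, Inr i)\<close> the \<open>i\<close>th rotational one (rotation angles). The
  configuration space has dimension \<open>n = CARD('n)\<close>.\<close>

definition skew :: "real ^ 3 \<Rightarrow> real ^ 3 ^ 3" where
  "skew x = matrix (cross3 x)"

lemma skew_mult_vec: "skew x *v y = cross3 x y"
proof -
  have "linear (cross3 x)"
    using bilinear_cross by (simp add: bilinear_def)
  then show ?thesis
    by (simp add: skew_def matrix_works)
qed

definition angles :: "(real ^ 'n \<Rightarrow> real ^ ('b::finite \<times> (3 + 3))) \<Rightarrow> 'b \<Rightarrow> real ^ 'n \<Rightarrow> real ^ 3" where
  "angles F l q = (\<chi> i. F q $ (l, Inr i))"

text \<open>\<open>E\<close> maps the rates of the rotation angles to the angular velocity in body-fixed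
  coordinates. The derivative of the matrix-valued curve exists if \<open>R\<close> is differentiable.\<close>

definition angular_rate_matrix ::
    "(real ^ 3 \<Rightarrow> real ^ 3 ^ 3) \<Rightarrow> (real ^ 3 \<Rightarrow> real ^ 3 ^ 3) \<Rightarrow> bool" where
  "angular_rate_matrix R E \<longleftrightarrow>
     (\<forall>\<phi> :: real \<Rightarrow> real ^ 3. (\<forall>t. \<phi> differentiable (at t)) \<longrightarrow>
       (\<forall>t. transpose (R (\<phi> t)) ** vector_derivative (\<lambda>s. R (\<phi> s)) (at t)
             = skew (E (\<phi> t) *v vector_derivative \<phi> (at t))))"

definition body_Q ::
    "(real ^ 3 \<Rightarrow> real ^ 3 ^ 3) \<Rightarrow> (real ^ 3 \<Rightarrow> real ^ 3 ^ 3) \<Rightarrow> real ^ 3 \<Rightarrow> real ^ (3 + 3) ^ (3 + 3)" where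
  "body_Q R E \<phi> = (\<chi> i j. case (i, j) of
       (Inl a, Inl b) \<Rightarrow> transpose (R \<phi>) $ a $ b
     | (Inr a, Inr b) \<Rightarrow> E \<phi> $ a $ b
     | _ \<Rightarrow> 0)"

definition chain_Q ::
    "(real ^ 'n \<Rightarrow> real ^ ('b::finite \<times> (3 + 3))) \<Rightarrow> (real ^ 3 \<Rightarrow> real ^ 3 ^ 3) \<Rightarrow> (real ^ 3 \<Rightarrow> real ^ 3 ^ 3)
      \<Rightarrow> real ^ 'n \<Rightarrow> real ^ ('b::finite \<times> (3 + 3)) ^ ('b::finite \<times> (3 + 3))" where
  "chain_Q F R E q = (\<chi> r s. if fst r = fst s
      then body_Q R E (angles F (fst r) q) $ snd r $ snd s else 0)"

abbreviation J :: "(real ^ 'n \<Rightarrow> real ^ 'k) \<Rightarrow> real ^ 'n \<Rightarrow> real ^ 'n ^ 'k" where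
  "J F q \<equiv> jacobian F (at q)"

definition K ::
    "(real ^ 'n \<Rightarrow> real ^ ('b::finite \<times> (3 + 3))) \<Rightarrow> (real ^ 3 \<Rightarrow> real ^ 3 ^ 3) \<Rightarrow> (real ^ 3 \<Rightarrow> real ^ 3 ^ 3)
      \<Rightarrow> 'b::finite \<times> (3 + 3) \<Rightarrow> real ^ 'n \<Rightarrow> real ^ 'n" where
  "K F R E p q = transpose (chain_Q F R E q ** J F q) *v axis p 1"

definition H ::
    "(real ^ 'n \<Rightarrow> real ^ ('b::finite \<times> (3 + 3))) \<Rightarrow> (real ^ 3 \<Rightarrow> real ^ 3 ^ 3) \<Rightarrow> (real ^ 3 \<Rightarrow> real ^ 3 ^ 3)
      \<Rightarrow> real ^ 'n \<Rightarrow> real ^ ('b::finite \<times> (3 + 3)) \<Rightarrow> real ^ 'n ^ 'n" where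
  "H F R E q \<Psi> =
    (let D = J (\<lambda>q. transpose (J F q) *v (transpose (chain_Q F R E q) *v \<Psi>)) q
     in D - transpose D)"


section \<open>Lumped velocity\<close>

definition stacked :: "real ^ 3 \<Rightarrow> real ^ 3 ^ (3 + 3)" where
  "stacked x = (\<chi> i. case i of Inl a \<Rightarrow> mat 1 $ a | Inr a \<Rightarrow> skew x $ a)"

definition lumped_integrand ::
    "('b \<Rightarrow> real ^ 3 \<Rightarrow> real \<Rightarrow> real) \<Rightarrow> ('b \<Rightarrow> real ^ 3 \<Rightarrow> real \<Rightarrow> real)
      \<Rightarrow> ('b \<Rightarrow> real ^ 3 \<Rightarrow> real \<Rightarrow> real ^ 3) \<Rightarrow> 'b \<Rightarrow> real \<Rightarrow> real ^ 3 \<Rightarrow> real ^ (3 + 3)" where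
  "lumped_integrand \<sigma> \<rho> v l t x = (\<sigma> l x t * \<rho> l x t) *\<^sub>R (stacked x *v v l x t)"

definition lumped_velocity ::
    "('b \<Rightarrow> real ^ 3 \<Rightarrow> real \<Rightarrow> real) \<Rightarrow> ('b \<Rightarrow> real ^ 3 \<Rightarrow> real \<Rightarrow> real)
      \<Rightarrow> ('b \<Rightarrow> real ^ 3 \<Rightarrow> real \<Rightarrow> real ^ 3) \<Rightarrow> real \<Rightarrow> real ^ ('b::finite \<times> (3 + 3))" where
  "lumped_velocity \<sigma> \<rho> v t =
     (\<chi> r. integral\<^sup>L lebesgue (lumped_integrand \<sigma> \<rho> v (fst r) t) $ snd r)"

end

theory Submission
  imports Defs
begin

text \<open>Since \<open>J\<^sup>T Q\<^sup>T \<Psi> = (\<Sum>p. \<Psi>\<^sub>p K\<^sub>p)\<close> with \<open>\<Psi>\<close> constant, \<open>H\<close> is the combination of the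
  antisymmetrized Jacobians of the \<open>K\<^sub>p\<close> with the coefficients \<open>\<Psi>\<^sub>p\<close>. The largest singular
  value is the Euclidean operator norm, so the triangle inequality bounds it by
  \<open>(\<Sum>p. \<bar>\<Psi>\<^sub>p\<bar>)\<close> times the largest individual bound, and Cauchy-Schwarz gives
  \<open>(\<Sum>p. \<bar>\<Psi>\<^sub>p\<bar>) \<le> sqrt (6 N) \<parallel>\<Psi>\<parallel>\<close>.\<close>

text \<open>Eigenvectors of a symmetric matrix for distinct eigenvalues are orthogonal, so one
  chosen per eigenvalue gives an independent, hence finite, family. Without finiteness the
  \<open>Max\<close> in \<open>lambda_max\<close> would say nothing.\<close>

lemma finite_eigenvalues_symmetric:
  fixes A :: "real ^ 'n ^ 'n"
  assumes sym: "transpose A = A"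
  shows "finite {l. \<exists>v. v \<noteq> 0 \<and> A *v v = l *\<^sub>R v}" (is "finite ?S")
proof -
  obtain f where f: "\<And>l. l \<in> ?S \<Longrightarrow> f l \<noteq> 0 \<and> A *v f l = l *\<^sub>R f l"
    using bchoice[of ?S "\<lambda>l v. v \<noteq> 0 \<and> A *v v = l *\<^sub>R v"] by blast
  have orth: "f k \<bullet> f l = 0" if "k \<in> ?S" "l \<in> ?S" "k \<noteq> l" for k l
  proof -
    have "k * (f k \<bullet> f l) = (A *v f k) \<bullet> f l"
      using f[OF that(1)] by simp
    also have "\<dots> = f k \<bullet> (A *v f l)"
      using sym by (metis dot_lmul_matrix inner_commute transpose_matrix_vector)
    also have "\<dots> = l * (f k \<bullet> f l)"
      using f[OF that(2)] by simp
    finally show ?thesis using that(3) by simp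
  qed
  \<comment> \<open>A vector shared by two distinct eigenvalues would be orthogonal to itself, hence
    zero.\<close>
  have inj: "inj_on f ?S"
    using orth f by (metis (no_types, lifting) inj_onI inner_eq_zero_iff)
  have "pairwise orthogonal (f ` ?S)"
    using orth unfolding pairwise_def orthogonal_def by (metis (no_types, lifting) imageE)
  moreover have "0 \<notin> f ` ?S" using f by (metis (no_types, lifting) imageE)
  ultimately have "independent (f ` ?S)"
    by (rule pairwise_orthogonal_independent)
  then have "finite (f ` ?S)" by (rule independent_imp_finite)
  then show ?thesis using inj finite_imageD by blast
qed

text \<open>Near 0 the linear term dominates, so a nonzero \<open>a\<close> would make the
  expression negative on one side of 0.\<close>

lemma linear_coeff_zero_of_quadratic_nonneg:
  fixes a b :: real
  assumes "\<And>t. 0 \<le> t * a + t\<^sup>2 * b"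
  shows "a = 0"
proof -
  \<comment> \<open>This \<open>d\<close> exceeds both 0 and \<open>b\<close>, so the value at
    \<open>t = - a / d\<close> has a negative factor \<open>b - d\<close> next to the square of
    \<open>a\<close>.\<close>
  define d where "d = \<bar>b\<bar> + 1"
  have d: "0 < d" "b - d < 0" unfolding d_def by linarith+
  have "0 \<le> (- a / d) * a + (- a / d)\<^sup>2 * b" by (rule assms)
  also have "\<dots> = a\<^sup>2 * (b - d) / d\<^sup>2"
    using d by (simp add: field_simps power2_eq_square)
  finally have "0 \<le> a\<^sup>2 * (b - d)"
    using d by (simp add: zero_le_divide_iff)
  then show ?thesis
    using d(2) by (metis less_eq_real_def mult_pos_neg not_le zero_less_power2)
qed

lemma norm_matrix_vector_square:
  fixes B :: "real ^ 'n ^ 'm"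
  shows "(norm (B *v x))\<^sup>2 = x \<bullet> ((transpose B ** B) *v x)"
  by (metis dot_lmul_matrix matrix_vector_mul_assoc power2_norm_eq_inner transpose_matrix_vector
      inner_commute)

text \<open>The unit sphere is compact, so the norm of \<open>B *v x\<close> has a maximizer there;
  homogeneity extends its bound to all vectors.\<close>

lemma onorm_matrix_attained:
  fixes B :: "real ^ 'n ^ 'm"
  obtains x where "norm x = 1" "norm (B *v x) = onorm ((*v) B)"
proof -
  have "compact (sphere (0::real^'n) 1)" by simp
  moreover have "sphere (0::real^'n) 1 \<noteq> {}"
    by (simp add: sphere_eq_empty)
  moreover have "continuous_on (sphere 0 1) (\<lambda>x. norm (B *v x))"
    by (intro continuous_intros)
  ultimately obtain x where x: "x \<in> sphere 0 1"
    "\<And>y. y \<in> sphere 0 1 \<Longrightarrow> norm (B *v y) \<le> norm (B *v x)"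
    using continuous_attains_sup[of "sphere (0::real^'n) 1" "\<lambda>x. norm (B *v x)"] by blast
  have "norm (B *v y) \<le> norm (B *v x) * norm y" for y
  proof (cases "y = 0")
    case False
    have "norm (B *v (y /\<^sub>R norm y)) \<le> norm (B *v x)"
      using False by (intro x(2)) simp
    then show ?thesis
      using False by (simp add: matrix_vector_mult_scaleR field_simps)
  qed simp
  then have "onorm ((*v) B) \<le> norm (B *v x)"
    by (intro onorm_bound) auto
  moreover have "norm (B *v x) \<le> onorm ((*v) B)"
    using onorm[of "(*v) B" x] x(1) by simp
  ultimately show ?thesis using that[of x] x(1) by simp
qed

text \<open>A variational argument: a unit vector at which the operator norm is attained is itself
  the eigenvector.\<close>

lemma onorm_square_eigenvalue:
  fixes B :: "real ^ 'n ^ 'm"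
  shows "\<exists>v. v \<noteq> 0 \<and> (transpose B ** B) *v v = (onorm ((*v) B))\<^sup>2 *\<^sub>R v"
proof -
  let ?A = "transpose B ** B" and ?m = "(onorm ((*v) B))\<^sup>2"
  obtain x where x: "norm x = 1" "norm (B *v x) = onorm ((*v) B)"
    by (rule onorm_matrix_attained)
  \<comment> \<open>\<open>w\<close> is the residual of the eigenvalue equation at \<open>x\<close>,
    so the goal is \<open>w = 0\<close>. The form \<open>g\<close> is the slack in the squared
    operator norm bound; it vanishes at \<open>x\<close>.\<close>
  define w where "w = ?m *\<^sub>R x - ?A *v x"
  define g where "g y = ?m * (y \<bullet> y) - y \<bullet> (?A *v y)" for y
  have sym: "y \<bullet> (?A *v z) = z \<bullet> (?A *v y)" for y z
    by (metis dot_lmul_matrix inner_commute matrix_transpose_mul transpose_matrix_vector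
        transpose_transpose)
  have nonneg: "0 \<le> g y" for y
  proof -
    have "norm (B *v y) \<le> onorm ((*v) B) * norm y"
      by (rule onorm) simp
    then have "(norm (B *v y))\<^sup>2 \<le> ?m * (norm y)\<^sup>2"
      by (metis norm_ge_zero power_mono power_mult_distrib)
    then show ?thesis
      unfolding g_def norm_matrix_vector_square by (simp add: power2_norm_eq_inner)
  qed
  have "g x = 0"
    unfolding g_def norm_matrix_vector_square[symmetric]
    using x by (simp add: power2_norm_eq_inner[symmetric])
  \<comment> \<open>\<open>x\<close> minimizes the nonnegative quadratic form \<open>g\<close>, so its derivative at \<open>x\<close> in the direction
    of its own gradient \<open>2 w\<close> vanishes.\<close>
  moreover have "g (x + t *\<^sub>R w) = g x + t * (2 * (w \<bullet> w)) + t\<^sup>2 * g w" for t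
  proof -
    have "w \<bullet> w = ?m * (x \<bullet> w) - w \<bullet> (?A *v x)"
      by (subst (2) w_def) (simp add: inner_diff_right inner_commute)
    moreover have "g (x + t *\<^sub>R w) = g x + t * (2 * (?m * (x \<bullet> w) - w \<bullet> (?A *v x))) + t\<^sup>2 * g w"
      using sym[of x w]
      by (simp add: g_def matrix_vector_right_distrib matrix_vector_mult_scaleR inner_add_left
          inner_add_right inner_commute[of w x] algebra_simps power2_eq_square)
    ultimately show ?thesis by simp
  qed
  ultimately have "0 \<le> t * (2 * (w \<bullet> w)) + t\<^sup>2 * g w" for t
    using nonneg[of "x + t *\<^sub>R w"] by simp
  then have "2 * (w \<bullet> w) = 0"
    by (rule linear_coeff_zero_of_quadratic_nonneg)
  then show ?thesis
    using x by (intro exI[of _ x]) (auto simp: w_def)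
qed

text \<open>The squared operator norm is an eigenvalue by the previous lemma. It is the largest,
  since an eigenvector \<open>v\<close> for \<open>l\<close> satisfies
  \<open>l * (norm v)^2 = (norm (B *v v))^2\<close>. This makes the triangle inequality available
  for \<open>sigma_max\<close>.\<close>

lemma sigma_max_eq_onorm:
  fixes B :: "real ^ 'n ^ 'm"
  shows "sigma_max B = onorm ((*v) B)"
proof -
  let ?A = "transpose B ** B"
  have "lambda_max ?A = (onorm ((*v) B))\<^sup>2"
    unfolding lambda_max_def
  proof (rule Max_eqI)
    show "finite {l. \<exists>v. v \<noteq> 0 \<and> ?A *v v = l *\<^sub>R v}"
      by (rule finite_eigenvalues_symmetric) (simp add: matrix_transpose_mul)
  next
    fix l
    assume "l \<in> {l. \<exists>v. v \<noteq> 0 \<and> ?A *v v = l *\<^sub>R v}"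
    then obtain v where v: "v \<noteq> 0" "?A *v v = l *\<^sub>R v" by blast
    have "l * (norm v)\<^sup>2 = (norm (B *v v))\<^sup>2"
      unfolding norm_matrix_vector_square v(2) by (simp add: power2_norm_eq_inner)
    also have "\<dots> \<le> (onorm ((*v) B) * norm v)\<^sup>2"
      by (intro power_mono onorm) simp_all
    finally show "l \<le> (onorm ((*v) B))\<^sup>2"
      using v(1) by (simp add: power_mult_distrib)
  qed (use onorm_square_eigenvalue[of B] in blast)
  then show ?thesis
    by (simp add: sigma_max_def onorm_pos_le)
qed

lemma sigma_max_nonneg: "0 \<le> sigma_max B"
  unfolding sigma_max_eq_onorm by (rule onorm_pos_le) simp

lemma sum_scaleR_matrix_vector_mult:
  fixes B :: "'k \<Rightarrow> real ^ 'n ^ 'm"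
  shows "(\<Sum>p\<in>S. c p *\<^sub>R B p) *v x = (\<Sum>p\<in>S. c p *\<^sub>R (B p *v x))"
  by (induction S rule: infinite_finite_induct)
    (simp_all add: matrix_vector_mult_add_rdistrib scaleR_matrix_vector_assoc)

lemma sigma_max_sum_le:
  fixes B :: "'k \<Rightarrow> real ^ 'n ^ 'm"
  assumes "\<And>p. p \<in> S \<Longrightarrow> sigma_max (B p) \<le> m"
  shows "sigma_max (\<Sum>p\<in>S. c p *\<^sub>R B p) \<le> (\<Sum>p\<in>S. \<bar>c p\<bar>) * m"
proof -
  have "norm ((\<Sum>p\<in>S. c p *\<^sub>R B p) *v x) \<le> (\<Sum>p\<in>S. \<bar>c p\<bar>) * m * norm x" for x
  proof -
    have "norm ((\<Sum>p\<in>S. c p *\<^sub>R B p) *v x) \<le> (\<Sum>p\<in>S. norm (c p *\<^sub>R (B p *v x)))"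
      by (simp only: sum_scaleR_matrix_vector_mult norm_sum)
    also have "\<dots> \<le> (\<Sum>p\<in>S. \<bar>c p\<bar> * (m * norm x))"
    proof (rule sum_mono)
      fix p assume "p \<in> S"
      have "norm (B p *v x) \<le> sigma_max (B p) * norm x"
        unfolding sigma_max_eq_onorm by (rule onorm) simp
      also have "\<dots> \<le> m * norm x"
        by (intro mult_right_mono assms \<open>p \<in> S\<close>) simp
      finally show "norm (c p *\<^sub>R (B p *v x)) \<le> \<bar>c p\<bar> * (m * norm x)"
        by (simp add: mult_left_mono)
    qed
    finally show ?thesis by (simp add: sum_distrib_right mult.assoc)
  qed
  then show ?thesis unfolding sigma_max_eq_onorm by (rule onorm_le)
qed

lemma sum_abs_le_sqrt_card_norm:
  fixes x :: "real ^ 'k"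
  shows "(\<Sum>p\<in>UNIV. \<bar>x $ p\<bar>) \<le> sqrt (real CARD('k)) * norm x"
  \<comment> \<open>Cauchy-Schwarz against the all-ones vector, whose norm is the square root of the
    dimension.\<close>
  using L2_set_mult_ineq[of "\<lambda>_. 1" "\<lambda>p. x $ p" "UNIV :: 'k set"]
  by (simp add: norm_vec_def L2_set_def)

text \<open>Differentiability of each \<open>K F R E p\<close> at \<open>q\<close> lets the
  derivative pass through the sum; \<open>jacobian\<close> is an unspecified choice where no
  derivative exists.\<close>

lemma H_eq_sum:
  fixes F :: "real ^ 'n \<Rightarrow> real ^ ('b::finite \<times> (3 + 3))"
  assumes "\<And>p. K F R E p differentiable (at q)"
  shows "H F R E q \<Psi> = (\<Sum>p\<in>UNIV. \<Psi> $ p *\<^sub>R (J (K F R E p) q - transpose (J (K F R E p) q)))"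
proof -
  have lump: "transpose (J F q) *v (transpose (chain_Q F R E q) *v \<Psi>)
      = (\<Sum>p\<in>UNIV. \<Psi> $ p *\<^sub>R K F R E p q)" for q
  proof -
    \<comment> \<open>Expanding the lumped velocity in the standard basis exposes the vectors
      \<open>K F R E p q\<close>, which are images of basis vectors.\<close>
    have "transpose (J F q) *v (transpose (chain_Q F R E q) *v \<Psi>)
        = transpose (chain_Q F R E q ** J F q) *v (\<Sum>p\<in>UNIV. \<Psi> $ p *\<^sub>R axis p 1)"
      using basis_expansion[of \<Psi>]
      by (simp add: matrix_transpose_mul matrix_vector_mul_assoc scalar_mult_eq_scaleR
          del: transpose_matrix_vector)
    also have "\<dots> = (\<Sum>p\<in>UNIV. \<Psi> $ p *\<^sub>R K F R E p q)"
      by (simp add: K_def linear_sum[OF matrix_vector_mul_linear]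
          matrix_vector_mult_scaleR)
    finally show ?thesis .
  qed
  have "((\<lambda>q. \<Sum>p\<in>UNIV. \<Psi> $ p *\<^sub>R K F R E p q) has_derivative
      (\<lambda>h. \<Sum>p\<in>UNIV. \<Psi> $ p *\<^sub>R (J (K F R E p) q *v h))) (at q)"
    using assms by (intro has_derivative_sum has_derivative_scaleR_right)
      (simp add: jacobian_works)
  moreover have "(\<lambda>h. \<Sum>p\<in>UNIV. \<Psi> $ p *\<^sub>R (J (K F R E p) q *v h))
      = (*v) (\<Sum>p\<in>UNIV. \<Psi> $ p *\<^sub>R J (K F R E p) q)"
    by (simp add: fun_eq_iff sum_scaleR_matrix_vector_mult)
  ultimately have deriv: "((\<lambda>q. \<Sum>p\<in>UNIV. \<Psi> $ p *\<^sub>R K F R E p q) has_derivative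
      (*v) (\<Sum>p\<in>UNIV. \<Psi> $ p *\<^sub>R J (K F R E p) q)) (at q)"
    by (simp only:)
  \<comment> \<open>Uniqueness of the derivative identifies the Jacobian with the matrix in
    \<open>deriv\<close>.\<close>
  have "J (\<lambda>q. \<Sum>p\<in>UNIV. \<Psi> $ p *\<^sub>R K F R E p q) q
      = (\<Sum>p\<in>UNIV. \<Psi> $ p *\<^sub>R J (K F R E p) q)"
    unfolding jacobian_def[of "\<lambda>q. \<Sum>p\<in>UNIV. \<Psi> $ p *\<^sub>R K F R E p q"]
      frechet_derivative_at[OF deriv, symmetric] by (rule matrix_of_matrix_vector_mul)
  moreover have "transpose (\<Sum>p\<in>UNIV. \<Psi> $ p *\<^sub>R J (K F R E p) q)
      = (\<Sum>p\<in>UNIV. \<Psi> $ p *\<^sub>R transpose (J (K F R E p) q))"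
    by (simp only: vec_eq_iff transpose_def vec_lambda_beta sum_component vector_scaleR_component)
      simp
  ultimately show ?thesis
    unfolding H_def Let_def lump by (simp only: scaleR_diff_right sum_subtractf)
qed

theorem theorem5:
  fixes F :: "real ^ 'n \<Rightarrow> real ^ ('b::finite \<times> (3 + 3))"
    and R E :: "real ^ 3 \<Rightarrow> real ^ 3 ^ 3"
    and \<sigma> \<rho> :: "'b \<Rightarrow> real ^ 3 \<Rightarrow> real \<Rightarrow> real"
    and v :: "'b \<Rightarrow> real ^ 3 \<Rightarrow> real \<Rightarrow> real ^ 3"
    and \<Psi>s :: real
  assumes F_diff: "\<And>q. F differentiable (at q)"
    and R_diff: "\<And>\<phi>. R differentiable (at \<phi>)"
    and R_rot: "\<And>\<phi>. rotation_matrix (R \<phi>)"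
    and E_rate: "angular_rate_matrix R E"
    and K_diff: "\<And>p q. K F R E p differentiable (at q)"
    and \<sigma>_range: "\<And>l x t. t \<ge> 0 \<Longrightarrow> \<sigma> l x t \<in> {0..1}"
    and \<rho>_nonneg: "\<And>l x t. t \<ge> 0 \<Longrightarrow> \<rho> l x t \<ge> 0"
    and \<Psi>_integrable: "\<And>l t. t \<ge> 0 \<Longrightarrow> integrable lebesgue (lumped_integrand \<sigma> \<rho> v l t)"
    and sup_finite: "\<And>p. (SUP q. ereal (sigma_max (J (K F R E p) q - transpose (J (K F R E p) q)))) < \<infinity>"
    and \<Psi>s_nonneg: "\<Psi>s \<ge> 0"
    and \<Psi>_bound: "\<And>t. t \<ge> 0 \<Longrightarrow> norm (lumped_velocity \<sigma> \<rho> v t) \<le> \<Psi>s"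
  shows "(MAX p. SUP q. ereal (sigma_max (J (K F R E p) q - transpose (J (K F R E p) q)))) < \<infinity>
    \<and> (\<forall>q. \<forall>t\<ge>0.
        ereal (sigma_max (H F R E q (lumped_velocity \<sigma> \<rho> v t)))
          \<le> ereal (sqrt (6 * real CARD('b)) * \<Psi>s)
            * (MAX p. SUP q. ereal (sigma_max (J (K F R E p) q - transpose (J (K F R E p) q)))))"
proof -
  let ?D = "\<lambda>p q. J (K F R E p) q - transpose (J (K F R E p) q)"
  let ?s = "\<lambda>p. SUP q. ereal (sigma_max (?D p q))"
  let ?M = "Max (range ?s)"
  have fin: "?M < \<infinity>"
  proof -
    have "?M \<in> range ?s" by (intro Max_in) simp_all
    then obtain p where "?M = ?s p" by blast
    then show ?thesis using sup_finite[of p] by (simp only:)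
  qed
  have le: "ereal (sigma_max (?D p q)) \<le> ?M" for p q
    by (rule order_trans[OF SUP_upper[of q UNIV] Max_ge]) auto
  \<comment> \<open>Nonnegativity excludes minus infinity; together with \<open>fin\<close> it makes
    the maximum a real \<open>m\<close>, so the estimate can be done over the reals.\<close>
  have "0 \<le> ?M"
    using order_trans[OF _ le] sigma_max_nonneg ereal_less_eq(5) by blast
  with fin obtain m where m: "?M = ereal m" "0 \<le> m"
    by (cases ?M) auto
  have "sigma_max (H F R E q (lumped_velocity \<sigma> \<rho> v t)) \<le> sqrt (6 * real CARD('b)) * \<Psi>s * m"
    if t: "0 \<le> t" for q t
  proof -
    let ?\<Psi> = "lumped_velocity \<sigma> \<rho> v t :: real ^ ('b \<times> (3 + 3))"
    have "sigma_max (H F R E q ?\<Psi>) \<le> (\<Sum>p\<in>UNIV. \<bar>?\<Psi> $ p\<bar>) * m"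
      unfolding H_eq_sum[OF K_diff] using le m(1) by (intro sigma_max_sum_le) simp
    \<comment> \<open>The factor 6 comes from the index type \<open>'b \<times> (3 + 3)\<close>,
      which has \<open>6 * CARD('b)\<close> elements.\<close>
    also have "\<dots> \<le> sqrt (6 * real CARD('b)) * norm ?\<Psi> * m"
      using sum_abs_le_sqrt_card_norm[of ?\<Psi>] m(2)
      by (intro mult_right_mono) (simp_all add: mult.commute)
    also have "\<dots> \<le> sqrt (6 * real CARD('b)) * \<Psi>s * m"
      by (intro mult_right_mono mult_left_mono \<Psi>_bound t m(2)) simp
    finally show ?thesis .
  qed
  then show ?thesis
    using fin by (simp add: m(1))
qed

end
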